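(* Let $N \geq 5$ and let $H$ be a fixed $N\times N$ Hermitian matrix with $N$ distinct real eigenvalues $\mu_1<\dots<\mu_N$. Let $v$ be a random unit vector, uniformly distributed on the unit sphere of $\mathbb{C}^N$, and for $t\ge 0$ let $G_t := H + i t\, vv^*$. Then, almost surely with respect to the randomness of $v$, the eigenvalue trajectories of $G_t$, $t\ge 0$, neither intersect nor self-intersect. Explicitly: almost surely, for every $t\ge 0$ the matrix $G_t$ has $N$ distinct eigenvalues, and for all $t,s\ge 0$ with $t\neq s$ the spectra of $G_t$ and $G_s$ are disjoint.
   Context: $vv^*$ denotes the rank-one orthogonal projection onto $v$. If $\lambda_1(t),\dots,\lambda_N(t)$ denote the eigenvalues of $G_t$ (with arbitrary indexing), the statement is: almost surely there are no $i\neq j$ and $t,s\ge 0$ with $\lambda_i(t)=\lambda_j(s)$, and no $j$ and $t\neq s$ with $\lambda_j(t)=\lambda_j(s)$. *)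

theory Defs
  imports "HOL-Analysis.Analysis"
begin

definition eigenvalues :: "complex^'n^'n \<Rightarrow> complex set" where
  "eigenvalues A = {c. \<exists>x :: complex^'n. x \<noteq> 0 \<and> A *v x = c *s x}"

definition hermitian :: "complex^'n^'n \<Rightarrow> bool" where
  "hermitian A \<longleftrightarrow> (\<forall>i j. A $ i $ j = cnj (A $ j $ i))"

definition outer_proj :: "complex^'n \<Rightarrow> complex^'n^'n" where
  "outer_proj v = (\<chi> i j. v $ i * cnj (v $ j))"

definition Gt :: "complex^'n^'n \<Rightarrow> complex^'n \<Rightarrow> real \<Rightarrow> complex^'n^'n" where
  "Gt H v t = H + (\<chi> i j. (\<i> * complex_of_real t) * outer_proj v $ i $ j)"

text \<open>Uniform (normalized surface) probability measure on the unit sphere of C^N,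
  realised as the radial projection of the uniform distribution on the unit ball.\<close>
definition sphere_unif :: "(complex^'n) measure" where
  "sphere_unif = distr (uniform_measure lborel (ball 0 1)) borel (\<lambda>x. x /\<^sub>R norm x)"

end

theory Submission
  imports Defs "HOL-Computational_Algebra.Fundamental_Theorem_Algebra"
begin

text \<open>In an orthonormal eigenbasis of \<open>H\<close>, with \<open>w\<close> the coordinate vector of \<open>v\<close> and all \<open>w k \<noteq> 0\<close>, a number \<open>c\<close> is
  an eigenvalue of \<open>G\<^sub>t\<close>, \<open>t > 0\<close>, iff \<open>c\<close> is none of the \<open>\<mu> k\<close> and \<open>F c = \<i> / t\<close>, where
  \<open>F c = (\<Sum>k. |w k|\<^sup>2 / (\<mu> k - c))\<close>. As \<open>F c\<close> determines \<open>t\<close>, the spectra for different times are disjoint.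
  A multiple eigenvalue is a nonreal \<open>c\<close> with \<open>F' c = 0\<close> and \<open>Re (F c) = 0\<close>: three real equations in \<open>w\<close> that depend on
  two real parameters. Solving them explicitly exhibits the exceptional \<open>w\<close> as the image of part of a real
  hyperplane under finitely many differentiable maps, a null set. The exceptional set is Borel and
  invariant under scaling, so that it is also null for the uniform measure on the sphere.\<close>

section \<open>Hermitian form, diagonalization and the secular equation\<close>

definition hdot :: "complex^'n \<Rightarrow> complex^'n \<Rightarrow> complex" where
  "hdot u v = (\<Sum>i\<in>UNIV. cnj (u $ i) * v $ i)"

definition adj :: "complex^'n^'m \<Rightarrow> complex^'m^'n" where
  "adj A = (\<chi> i j. cnj (A $ j $ i))"

definition diag :: "('n \<Rightarrow> real) \<Rightarrow> complex^'n^'n" where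
  "diag \<mu> = (\<chi> i j. if i = j then of_real (\<mu> i) else 0)"

lemma hdot_self: "hdot x x = of_real ((norm x)\<^sup>2)"
  by (simp add: hdot_def norm_vec_def L2_set_def sum_nonneg complex_norm_square mult.commute del: of_real_power)

lemma hdot_scale_right: "hdot u (c *s v) = c * hdot u v"
  by (simp add: hdot_def sum_distrib_left mult_ac)

lemma hdot_scale_left: "hdot (c *s u) v = cnj c * hdot u v"
  by (simp add: hdot_def sum_distrib_left mult_ac)

lemma hdot_hermitian:
  assumes "hermitian H"
  shows "hdot (H *v u) v = hdot u (H *v v)"
proof -
  have H: "cnj (H $ i $ j) = H $ j $ i" for i j
    using assms by (metis complex_cnj_cnj hermitian_def)
  have "hdot (H *v u) v = (\<Sum>i\<in>UNIV. \<Sum>j\<in>UNIV. cnj (u $ j) * H $ j $ i * v $ i)"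
    by (simp add: hdot_def matrix_vector_mult_def sum_distrib_right sum_distrib_left H mult_ac)
  also have "\<dots> = (\<Sum>j\<in>UNIV. \<Sum>i\<in>UNIV. cnj (u $ j) * H $ j $ i * v $ i)"
    by (rule sum.swap)
  also have "\<dots> = hdot u (H *v v)"
    by (simp add: hdot_def matrix_vector_mult_def sum_distrib_left mult_ac)
  finally show ?thesis .
qed

lemma hermitian_eigenvector_real:
  assumes "hermitian H" "x \<noteq> 0" "H *v x = c *s x"
  shows "Im c = 0"
proof -
  have "cnj c * hdot x x = c * hdot x x"
    using hdot_hermitian[OF assms(1), of x x] assms(3) by (simp add: hdot_scale_left hdot_scale_right)
  moreover have "hdot x x \<noteq> 0"
    using assms(2) by (simp add: hdot_self)
  ultimately have "cnj c = c" by simp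
  then show ?thesis by (simp add: complex_eq_iff)
qed

text \<open>With as many eigenvalues as dimensions, one unit eigenvector for each fills a square
  matrix \<open>E\<close>; eigenvectors for distinct real eigenvalues are orthogonal.\<close>

lemma hermitian_diagonalization:
  fixes H :: "complex^'n^'n"
  assumes "hermitian H" "card (eigenvalues H) = CARD('n)"
  obtains E :: "complex^'n^'n" and \<mu> :: "'n \<Rightarrow> real"
  where "inj \<mu>" "adj E ** E = mat 1" "H ** E = E ** diag \<mu>"
proof -
  \<comment> \<open>An infinite set has \<open>card\<close> 0, whereas \<open>CARD('n)\<close> is
    positive.\<close>
  have "finite (eigenvalues H)"
    using assms(2) by (metis card.infinite zero_less_card_finite less_numeral_extra(3))
  then obtain l where l: "bij_betw l (UNIV::'n set) (eigenvalues H)"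
    using assms(2) by (metis finite finite_same_card_bij)
  have "\<exists>x. norm x = 1 \<and> H *v x = l k *s x" for k
  proof -
    have "l k \<in> eigenvalues H" using l by (auto simp: bij_betw_def)
    then obtain x where x: "x \<noteq> 0" "H *v x = l k *s x" by (auto simp: eigenvalues_def)
    define y where "y = complex_of_real (1 / norm x) *s x"
    have y: "y = x /\<^sub>R norm x"
      unfolding y_def vec_eq_iff vector_scaleR_component vector_smult_component
      by (simp only: scaleR_conv_of_real) (simp add: divide_inverse)
    have "norm y = 1" using x(1) by (simp add: y)
    moreover have "H *v y = l k *s y"
      by (simp add: y_def x(2) vec.scale mult_ac vector_smult_assoc)
    ultimately show ?thesis by blast
  qed
  then obtain e where e: "\<And>k. norm (e k) = 1" "\<And>k. H *v e k = l k *s e k" by metis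
  define \<mu> where "\<mu> k = Re (l k)" for k
  have l\<mu>: "l k = of_real (\<mu> k)" for k
    using hermitian_eigenvector_real[OF assms(1) _ e(2)] e(1)[of k]
    by (metis complex_eq_iff Re_complex_of_real Im_complex_of_real \<mu>_def norm_zero zero_neq_one)
  have inj: "inj \<mu>"
    using l l\<mu> by (auto simp: inj_def bij_betw_def)
  have orth: "hdot (e j) (e k) = (if j = k then 1 else 0)" for j k
  proof (cases "j = k")
    case False
    \<comment> \<open>Both sides equal \<open>hdot (H *v e j) (e k)\<close>, since \<open>H\<close>
      moves across the form and the eigenvalues are real.\<close>
    have "of_real (\<mu> j) * hdot (e j) (e k) = of_real (\<mu> k) * hdot (e j) (e k)"
      using hdot_hermitian[OF assms(1), of "e j" "e k"]
      by (simp add: e(2) l\<mu> hdot_scale_left hdot_scale_right)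
    then show ?thesis using False inj by (auto simp: inj_def)
  qed (simp add: hdot_self e)
  define E :: "complex^'n^'n" where "E = (\<chi> i k. e k $ i)"
  have "adj E ** E = mat 1"
    using orth by (simp add: vec_eq_iff matrix_matrix_mult_def mat_def adj_def E_def hdot_def)
  moreover have "H ** E = E ** diag \<mu>"
  proof -
    have "(H ** E) $ i $ k = (E ** diag \<mu>) $ i $ k" for i k
    proof -
      have "(H ** E) $ i $ k = (H *v e k) $ i"
        by (simp add: matrix_matrix_mult_def matrix_vector_mult_def E_def)
      also have "\<dots> = e k $ i * of_real (\<mu> k)" by (simp add: e l\<mu>)
      also have "\<dots> = (E ** diag \<mu>) $ i $ k"
        by (simp add: matrix_matrix_mult_def diag_def E_def if_distrib[of "\<lambda>x. _ * x"] cong: if_cong)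
      finally show ?thesis .
    qed
    then show ?thesis by (simp add: vec_eq_iff)
  qed
  ultimately show thesis using inj that by blast
qed

text \<open>\<open>E\<close> maps eigenvectors of \<open>B\<close> to eigenvectors of
  \<open>A\<close>; the converse is the same argument for \<open>E'\<close>, as
  \<open>B ** E' = E' ** A\<close>.\<close>

lemma eigenvalues_similar:
  fixes A B E E' :: "complex^'n^'n"
  assumes "E' ** E = mat 1" "A ** E = E ** B"
  shows "eigenvalues A = eigenvalues B"
proof -
  have EE': "E ** E' = mat 1" using assms(1) matrix_left_right_inverse by blast
  have *: "eigenvalues B \<subseteq> eigenvalues A" if "E' ** E = mat 1" "A ** E = E ** B"
    for A B E E' :: "complex^'n^'n"
  proof
    fix c assume "c \<in> eigenvalues B"
    then obtain x where x: "x \<noteq> 0" "B *v x = c *s x" by (auto simp: eigenvalues_def)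
    have "E *v x \<noteq> 0"
      using x(1) that(1) by (metis matrix_vector_mul_assoc matrix_vector_mul_lid matrix_vector_mult_0_right)
    moreover have "A *v (E *v x) = c *s (E *v x)"
      using x(2) that(2) by (metis matrix_vector_mul_assoc vec.scale)
    ultimately show "c \<in> eigenvalues A" by (auto simp: eigenvalues_def)
  qed
  have "B ** E' = E' ** A"
    by (metis assms EE' matrix_mul_assoc matrix_mul_lid matrix_mul_rid)
  then show ?thesis using *[OF assms] *[OF EE'] by blast
qed

lemma Gt_conv_matrix_vector: "Gt H v t *v x = H *v x + (\<i> * of_real t * hdot v x) *s v"
  by (simp add: vec_eq_iff Gt_def matrix_vector_mult_def outer_proj_def hdot_def
      sum_distrib_left sum_distrib_right sum.distrib algebra_simps)

lemma hdot_adj: "hdot (E *v w) u = hdot w (adj E *v u)"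
proof -
  have "hdot (E *v w) u = (\<Sum>i\<in>UNIV. \<Sum>j\<in>UNIV. cnj (w $ j) * cnj (E $ i $ j) * u $ i)"
    by (simp add: hdot_def matrix_vector_mult_def sum_distrib_left sum_distrib_right mult_ac)
  also have "\<dots> = (\<Sum>j\<in>UNIV. \<Sum>i\<in>UNIV. cnj (w $ j) * cnj (E $ i $ j) * u $ i)"
    by (rule sum.swap)
  also have "\<dots> = hdot w (adj E *v u)"
    by (simp add: hdot_def matrix_vector_mult_def adj_def sum_distrib_left mult_ac)
  finally show ?thesis .
qed

text \<open>Unitarity of \<open>E\<close> turns the rank-one part built from \<open>v\<close> into
  the one built from its coordinate vector \<open>adj E *v v\<close>.\<close>

lemma eigenvalues_Gt_diagonalized:
  fixes H E :: "complex^'n^'n"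
  assumes "adj E ** E = mat 1" "H ** E = E ** diag \<mu>"
  shows "eigenvalues (Gt H v t) = eigenvalues (Gt (diag \<mu>) (adj E *v v) t)"
proof (rule eigenvalues_similar[OF assms(1)])
  have "E ** adj E = mat 1" using assms(1) matrix_left_right_inverse by blast
  then have v: "v = E *v (adj E *v v)"
    by (simp add: matrix_vector_mul_assoc)
  show "Gt H v t ** E = E ** Gt (diag \<mu>) (adj E *v v) t"
    unfolding matrix_eq
  proof
    fix x
    have "hdot v (E *v x) = hdot (adj E *v v) x"
      using hdot_adj[of E "adj E *v v" "E *v x"] v by (simp add: matrix_vector_mul_assoc assms(1))
    then show "(Gt H v t ** E) *v x = (E ** Gt (diag \<mu>) (adj E *v v) t) *v x"
      unfolding matrix_vector_mul_assoc[symmetric] Gt_conv_matrix_vector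
      by (subst (2) v) (simp add: matrix_vector_mul_assoc assms matrix_vector_right_distrib vec.scale)
  qed
qed

text \<open>Componentwise the eigenvector equation reads
  \<open>(\<mu> k - c) * x k = - \<i> * t * h * w k\<close> with \<open>h = hdot w x\<close>.
  Dividing by \<open>\<mu> k - c\<close> and pairing with \<open>w\<close> cancels \<open>h\<close>
  and leaves the secular equation.\<close>

lemma eigenvalues_Gt_diag:
  fixes w :: "complex^'n"
  assumes "inj \<mu>" "\<And>k. w $ k \<noteq> 0" "t > 0"
  shows "eigenvalues (Gt (diag \<mu>) w t) =
    {c. c \<notin> range (\<lambda>k. of_real (\<mu> k)) \<and>
        1 + \<i> * of_real t * (\<Sum>k\<in>UNIV. of_real ((cmod (w $ k))\<^sup>2) / (of_real (\<mu> k) - c)) = 0}"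
    (is "?L = ?R")
proof -
  have eq: "Gt (diag \<mu>) w t *v x = c *s x \<longleftrightarrow>
      (\<forall>k. (of_real (\<mu> k) - c) * x $ k + \<i> * of_real t * hdot w x * w $ k = 0)" for x c
  proof -
    have "(diag \<mu> *v x) $ k = of_real (\<mu> k) * x $ k" for k
      by (simp add: matrix_vector_mult_def diag_def if_distrib[of "\<lambda>y. y * _"] cong: if_cong)
    then show ?thesis
      by (simp add: Gt_conv_matrix_vector vec_eq_iff algebra_simps eq_diff_eq)
  qed
  show ?thesis
  proof (intro equalityI subsetI)
    fix c assume "c \<in> ?L"
    then obtain x where x: "x \<noteq> 0"
      and xk: "\<And>k. (of_real (\<mu> k) - c) * x $ k + \<i> * of_real t * hdot w x * w $ k = 0"
      by (auto simp: eigenvalues_def eq)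
    \<comment> \<open>If \<open>c = \<mu> k\<close>, the \<open>k\<close>-th equation forces
      \<open>hdot w x = 0\<close>, the others make \<open>x j = 0\<close> for
      \<open>j \<noteq> k\<close>, and then \<open>hdot w x = cnj (w k) * x k\<close> kills the last
      coordinate.\<close>
    have c: "of_real (\<mu> k) \<noteq> c" for k
    proof
      assume k: "of_real (\<mu> k) = c"
      have h: "hdot w x = 0" using xk[of k] k assms by simp
      have 0: "x $ j = 0" if "j \<noteq> k" for j
        using xk[of j] h that k assms(1) by (auto simp: inj_def)
      have "hdot w x = (\<Sum>j\<in>UNIV. if j = k then cnj (w $ k) * x $ k else 0)"
        unfolding hdot_def by (rule sum.cong) (auto simp: 0)
      then have "x $ k = 0" using h assms(2)[of k] by simp
      then show False using x 0 by (metis vec_eq_iff zero_index)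
    qed
    have xk': "x $ k = - (\<i> * of_real t * hdot w x * w $ k) / (of_real (\<mu> k) - c)" for k
      using xk[of k] c[of k] by (simp add: field_simps eq_neg_iff_add_eq_0)
    have s: "hdot w x \<noteq> 0"
      using xk' x by (auto simp: vec_eq_iff)
    have "hdot w x = (\<Sum>k\<in>UNIV. cnj (w $ k) * (- (\<i> * of_real t * hdot w x * w $ k) / (of_real (\<mu> k) - c)))"
      unfolding hdot_def[of w x] by (subst xk') (simp add: hdot_def)
    also have "\<dots> = hdot w x * (- \<i> * of_real t * (\<Sum>k\<in>UNIV. of_real ((cmod (w $ k))\<^sup>2) / (of_real (\<mu> k) - c)))"
      unfolding complex_norm_square sum_distrib_left by (rule sum.cong) (auto simp: divide_inverse)
    finally have "1 = - \<i> * of_real t * (\<Sum>k\<in>UNIV. of_real ((cmod (w $ k))\<^sup>2) / (of_real (\<mu> k) - c))"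
      using s by (metis mult_cancel_left2)
    then have "1 + \<i> * of_real t * (\<Sum>k\<in>UNIV. of_real ((cmod (w $ k))\<^sup>2) / (of_real (\<mu> k) - c)) = 0"
      by (simp only: mult_minus_left eq_neg_iff_add_eq_0)
    then show "c \<in> ?R" using c by auto
  next
    fix c assume c: "c \<in> ?R"
    \<comment> \<open>The solution of the componentwise equation, normalized so that
      \<open>\<i> * t * hdot w x = -1\<close>.\<close>
    define x where "x = (\<chi> k. w $ k / (of_real (\<mu> k) - c))"
    have "hdot w x = (\<Sum>k\<in>UNIV. of_real ((cmod (w $ k))\<^sup>2) / (of_real (\<mu> k) - c))"
      unfolding complex_norm_square hdot_def x_def by (rule sum.cong) (auto simp: mult_ac)
    then have h: "\<i> * of_real t * hdot w x = -1" using c by (simp add: eq_neg_iff_add_eq_0 add.commute)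
    have "x \<noteq> 0" using h by (auto simp: hdot_def)
    moreover have "Gt (diag \<mu>) w t *v x = c *s x"
      unfolding eq h using c by (auto simp: x_def)
    ultimately show "c \<in> ?L" by (auto simp: eigenvalues_def)
  qed
qed

section \<open>Counting the zeros of a sum of partial fractions\<close>

text \<open>Clearing denominators gives a polynomial \<open>q\<close> of degree
  \<open>CARD('n)\<close>. Nonzero residues keep it from vanishing at the poles, so it has the same
  zeros; \<open>simple\<close> makes it squarefree, so its roots are as many as its degree.\<close>

lemma card_zeros_partial_fractions:
  fixes a r :: "'n::finite \<Rightarrow> complex"
  assumes "inj a" "\<And>k. r k \<noteq> 0"
    and simple: "\<And>c. c \<notin> range a \<Longrightarrow> 1 + (\<Sum>k\<in>UNIV. r k / (a k - c)) = 0 \<Longrightarrow>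
      (\<Sum>k\<in>UNIV. r k / (a k - c)\<^sup>2) \<noteq> 0"
  shows "card {c. c \<notin> range a \<and> 1 + (\<Sum>k\<in>UNIV. r k / (a k - c)) = 0} = CARD('n)"
proof -
  define g where "g c = 1 + (\<Sum>k\<in>UNIV. r k / (a k - c))" for c
  define q where "q = (\<Prod>k\<in>UNIV. [:a k, -1:]) + (\<Sum>k\<in>UNIV. smult (r k) (\<Prod>j\<in>UNIV-{k}. [:a j, -1:]))"
  have deg_prod: "degree (\<Prod>k\<in>A. [:a k, -1:]) = card A" for A :: "'n set"
    by (subst degree_prod_eq_sum_degree) auto
  have "degree (\<Sum>k\<in>UNIV. smult (r k) (\<Prod>j\<in>UNIV-{k}. [:a j, -1:])) \<le> CARD('n) - 1"
    by (rule degree_sum_le) (auto simp: deg_prod card_Diff_singleton intro!: order_trans[OF degree_smult_le])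
  then have "degree (\<Sum>k\<in>UNIV. smult (r k) (\<Prod>j\<in>UNIV-{k}. [:a j, -1:])) < CARD('n)"
    using zero_less_card_finite[where 'a='n] by linarith
  then have degq: "degree q = CARD('n)"
    unfolding q_def by (subst degree_add_eq_left) (auto simp: deg_prod)
  have q: "poly q c = (\<Prod>k\<in>UNIV. a k - c) * g c" if "c \<notin> range a" for c
  proof -
    have "(\<Prod>j\<in>UNIV-{k}. a j - c) = (\<Prod>j\<in>UNIV. a j - c) / (a k - c)" for k
      using that by (subst prod.remove[of UNIV k]) auto
    then show ?thesis
      by (simp add: q_def g_def poly_prod poly_sum distrib_left sum_distrib_left mult_ac)
  qed
  have qa: "poly q (a k) \<noteq> 0" for k
  proof -
    have z: "(\<Prod>j\<in>A. a j - a k) = 0" if "k \<in> A" for A :: "'n set"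
      using that by (simp add: prod_zero_iff) blast
    have "poly q (a k) = (\<Sum>i\<in>UNIV. r i * (\<Prod>j\<in>UNIV-{i}. a j - a k))"
      by (simp add: q_def poly_sum poly_prod z)
    \<comment> \<open>Products over index sets containing \<open>k\<close> have the factor
      \<open>a k - a k\<close>; only the summand \<open>i = k\<close> survives.\<close>
    also have "\<dots> = (\<Sum>i\<in>UNIV. if i = k then r k * (\<Prod>j\<in>UNIV-{k}. a j - a k) else 0)"
      by (rule sum.cong) (auto simp: z)
    also have "\<dots> \<noteq> 0"
      using assms(1,2) by (auto simp: inj_def)
    finally show ?thesis .
  qed
  have roots: "poly q c = 0 \<longleftrightarrow> c \<notin> range a \<and> g c = 0" for c
    using q[of c] qa by (cases "c \<in> range a") auto
  have "rsquarefree q"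
    unfolding rsquarefree_roots
  proof (intro allI notI, elim conjE)
    fix c assume c: "poly q c = 0" "poly (pderiv q) c = 0"
    then have nc: "c \<notin> range a" and gc: "g c = 0" using roots by auto
    have "open (- range a)"
      by (simp add: finite_imp_closed open_Compl)
    \<comment> \<open>Near \<open>c\<close> this product agrees with \<open>q\<close>, so its
      derivative at \<open>c\<close> is 0; as \<open>g c = 0\<close>, the product rule leaves only
      the factor product times \<open>g' c\<close>.\<close>
    then have "((\<lambda>z. (\<Prod>k\<in>UNIV. a k - z) * g z) has_field_derivative 0) (at c)"
      using has_field_derivative_transform_within_open[OF poly_DERIV[of q c], of "- range a" "\<lambda>z. (\<Prod>k\<in>UNIV. a k - z) * g z"]
        nc q c(2) by auto
    moreover obtain D where D: "((\<lambda>z. \<Prod>k\<in>UNIV. a k - z) has_field_derivative D) (at c)"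
    proof -
      have "(\<lambda>z. \<Prod>k\<in>UNIV. a k - z) = poly (\<Prod>k\<in>UNIV. [:a k, -1:])"
        by (auto simp: poly_prod)
      then show thesis using that poly_DERIV by metis
    qed
    moreover have "(g has_field_derivative (\<Sum>k\<in>UNIV. r k / (a k - c)\<^sup>2)) (at c)"
      unfolding g_def using nc by (auto intro!: derivative_eq_intros sum.cong simp: power2_eq_square)
    ultimately have "(\<Prod>k\<in>UNIV. a k - c) * (\<Sum>k\<in>UNIV. r k / (a k - c)\<^sup>2) = 0"
      using DERIV_unique[OF _ DERIV_mult[OF D]] gc by fastforce
    then show False using simple[OF nc] gc nc by (auto simp: g_def)
  qed
  then have "smult (lead_coeff q) (\<Prod>z | poly q z = 0. [:-z, 1:]) = q"
    by (rule complex_poly_decompose_rsquarefree)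
  moreover have "degree (\<Prod>z | poly q z = 0. [:-z, 1:]) = card {z. poly q z = 0}"
    by (subst degree_prod_eq_sum_degree) auto
  ultimately have "card {z. poly q z = 0} = degree q"
    by (metis degree_0 degree_smult_eq leading_coeff_0_iff smult_0_left degq zero_less_card_finite less_numeral_extra(3))
  then show ?thesis using degq by (simp add: roots g_def)
qed

section \<open>The critical set and its negligibility\<close>

text \<open>With \<open>d k = \<mu> k - Re z\<close>, \<open>y = Im z\<close> and \<open>F z = (\<Sum>k. |w k|\<^sup>2 / (\<mu> k - z))\<close>, the real and imaginary
  parts of \<open>F' z\<close> are \<open>\<Sum>k. m k * (d k ^ 2 - y ^ 2)\<close> and \<open>2 * y * (\<Sum>k. m k * d k)\<close> for the weights \<open>m\<close> below,
  and \<open>Re (F z) = (\<Sum>k. m k * d k ^ 3) + y ^ 2 * (\<Sum>k. m k * d k)\<close>. In this form \<open>y\<close> enters only one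
  equation, which determines it from the other parameters.\<close>

definition weight :: "('n::finite \<Rightarrow> real) \<Rightarrow> complex^'n \<Rightarrow> complex \<Rightarrow> 'n \<Rightarrow> real" where
  "weight \<mu> w z k = (cmod (w $ k))\<^sup>2 / ((\<mu> k - Re z)\<^sup>2 + (Im z)\<^sup>2)\<^sup>2"

text \<open>Some nonreal \<open>z\<close> satisfies \<open>F' z = 0\<close> and
  \<open>Re (F z) = 0\<close>. Since the first-moment sum vanishes, the third-moment sum is
  \<open>Re (F z)\<close>. No time occurs, so one set serves all \<open>t > 0\<close>.\<close>

definition critical_set :: "('n::finite \<Rightarrow> real) \<Rightarrow> (complex^'n) set" where
  "critical_set \<mu> = {w. \<exists>z. Im z \<noteq> 0 \<and>
     (\<Sum>k\<in>UNIV. weight \<mu> w z k * (\<mu> k - Re z)) = 0 \<and>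
     (\<Sum>k\<in>UNIV. weight \<mu> w z k * (\<mu> k - Re z) ^ 3) = 0 \<and>
     (\<Sum>k\<in>UNIV. weight \<mu> w z k * ((\<mu> k - Re z)\<^sup>2 - (Im z)\<^sup>2)) = 0}"

text \<open>\<open>eq\<close> says \<open>F = \<i> / t\<close>, which makes \<open>Re F = 0\<close>
  and forces \<open>c\<close> off the real axis; \<open>deq\<close> is the vanishing of the
  derivative.\<close>

lemma double_root_imp_critical:
  fixes w :: "complex^'n"
  assumes "t > 0"
    and eq: "1 + \<i> * of_real t * (\<Sum>k\<in>UNIV. of_real ((cmod (w $ k))\<^sup>2) / (of_real (\<mu> k) - c)) = 0"
    and deq: "(\<Sum>k\<in>UNIV. of_real ((cmod (w $ k))\<^sup>2) / (of_real (\<mu> k) - c)\<^sup>2) = (0::complex)"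
  shows "w \<in> critical_set \<mu>"
proof -
  define p where "p k = (cmod (w $ k))\<^sup>2" for k
  define d where "d k = \<mu> k - Re c" for k
  define y where "y = Im c"
  define F where "F = (\<Sum>k\<in>UNIV. of_real (p k) / (of_real (\<mu> k) - c))"
  have ReF: "Re F = 0" and ImF: "Im F \<noteq> 0"
    using arg_cong[OF eq, of Re] arg_cong[OF eq, of Im] assms(1) unfolding F_def p_def by auto
  \<comment> \<open>For real \<open>c\<close> every summand of \<open>F\<close> is real, also if
    \<open>\<mu> k = c\<close>, where division by zero gives 0.\<close>
  have y: "y \<noteq> 0"
    using ImF by (auto simp: F_def y_def Im_divide)
  have pos: "d k ^ 2 + y ^ 2 > 0" for k
    using y by (simp add: sum_power2_gt_zero_iff)
  define m where "m k = weight \<mu> w c k" for k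
  have m: "m k = p k / (d k ^ 2 + y ^ 2)\<^sup>2" for k
    by (simp add: m_def weight_def p_def d_def y_def)
  \<comment> \<open>This is \<open>1 / (d - \<i> * y)^2 = (d + \<i> * y)^2 / (d^2 + y^2)^2\<close>,
    split into real and imaginary parts.\<close>
  have "of_real (p k) / (of_real (\<mu> k) - c)\<^sup>2 = Complex (m k * (d k ^ 2 - y ^ 2)) (2 * y * (m k * d k))" for k
  proof -
    have mc: "of_real (\<mu> k) - c = Complex (d k) (- y)" by (simp add: complex_eq_iff d_def y_def)
    have "(Complex (d k) (-y))\<^sup>2 * Complex (m k * (d k ^ 2 - y ^ 2)) (2 * y * (m k * d k)) = of_real (m k * (d k ^ 2 + y ^ 2)\<^sup>2)"
      by (simp add: complex_eq_iff power2_eq_square algebra_simps)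
    also have "m k * (d k ^ 2 + y ^ 2)\<^sup>2 = p k" using y by (simp add: m)
    finally have e: "of_real (p k) = (Complex (d k) (-y))\<^sup>2 * Complex (m k * (d k ^ 2 - y ^ 2)) (2 * y * (m k * d k))"
      by (rule sym)
    have "Complex (d k) (- y) \<noteq> 0" using y by (simp add: complex_eq_iff)
    then show ?thesis
      unfolding mc e by (rule nonzero_mult_div_cancel_left[OF power_not_zero])
  qed
  then have D: "(\<Sum>k\<in>UNIV. Complex (m k * (d k ^ 2 - y ^ 2)) (2 * y * (m k * d k))) = 0"
    using deq by (simp add: p_def)
  have 1: "(\<Sum>k\<in>UNIV. m k * (d k ^ 2 - y ^ 2)) = 0"
    using arg_cong[OF D, of Re] by simp
  have 2: "(\<Sum>k\<in>UNIV. m k * d k) = 0"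
    using arg_cong[OF D, of Im] y by (simp flip: sum_distrib_left)
  have "Re F = (\<Sum>k\<in>UNIV. m k * d k ^ 3 + y ^ 2 * (m k * d k))"
    unfolding F_def Re_sum
  proof (rule sum.cong)
    fix k
    have "Re (of_real (p k) / (of_real (\<mu> k) - c)) = p k * d k / (d k ^ 2 + y ^ 2)"
      by (simp add: Re_divide d_def y_def)
    also have "\<dots> = m k * d k * (d k ^ 2 + y ^ 2)"
      using pos[of k] by (simp add: m power2_eq_square)
    finally show "Re (of_real (p k) / (of_real (\<mu> k) - c)) = m k * d k ^ 3 + y ^ 2 * (m k * d k)"
      by (simp add: algebra_simps power2_eq_square power3_eq_cube)
  qed auto
  then have 3: "(\<Sum>k\<in>UNIV. m k * d k ^ 3) = 0"
    using ReF 2 by (simp add: sum.distrib flip: sum_distrib_left)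
  show ?thesis
    using 1 2 3 y unfolding critical_set_def m_def d_def y_def by blast
qed

text \<open>If all nonzero \<open>\<mu> k - x\<close> had the same square, \<open>\<mu>\<close>
  would take at most three values: \<open>x\<close> and two points symmetric about it.\<close>

lemma exists_pair_distinct_squares:
  fixes \<mu> :: "'n::finite \<Rightarrow> real"
  assumes "inj \<mu>" "CARD('n) \<ge> 4"
  obtains a b where "\<mu> a \<noteq> x" "\<mu> b \<noteq> x" "(\<mu> a - x)\<^sup>2 \<noteq> (\<mu> b - x)\<^sup>2"
proof -
  have "\<exists>a b. \<mu> a \<noteq> x \<and> \<mu> b \<noteq> x \<and> (\<mu> a - x)\<^sup>2 \<noteq> (\<mu> b - x)\<^sup>2"
  proof (rule ccontr)
    assume neg: "\<not> ?thesis"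
    have "\<exists>a. range \<mu> \<subseteq> {x, \<mu> a, 2 * x - \<mu> a}"
    proof (cases "\<exists>a. \<mu> a \<noteq> x")
      case True
      then obtain a where a: "\<mu> a \<noteq> x" by blast
      have "\<mu> b \<in> {x, \<mu> a, 2 * x - \<mu> a}" for b
        using neg a power2_eq_iff[of "\<mu> a - x" "\<mu> b - x"] by (cases "\<mu> b = x") fastforce+
      then show ?thesis by blast
    qed auto
    then obtain a where "range \<mu> \<subseteq> {x, \<mu> a, 2 * x - \<mu> a}" by blast
    then have "card (range \<mu>) \<le> card {x, \<mu> a, 2 * x - \<mu> a}"
      by (rule card_mono[rotated]) simp
    also have "\<dots> \<le> 3" by (simp add: card_insert_if)
    finally show False using assms by (simp add: card_image)
  qed
  then show thesis using that by blast
qed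

text \<open>The value of \<open>m a\<close> forced by \<open>\<Sum>k. m k * d k = 0\<close> and \<open>\<Sum>k. m k * d k ^ 3 = 0\<close>,
  in terms of the \<open>m j\<close> with \<open>j \<notin> {a, b}\<close>.\<close>

definition solve_pair :: "('n::finite \<Rightarrow> real) \<Rightarrow> ('n \<Rightarrow> real) \<Rightarrow> 'n \<Rightarrow> 'n \<Rightarrow> real" where
  "solve_pair m d a b = - (\<Sum>j\<in>UNIV-{a,b}. m j * (d j * ((d j)\<^sup>2 - (d b)\<^sup>2))) / (d a * ((d a)\<^sup>2 - (d b)\<^sup>2))"

text \<open>Subtracting \<open>(d b)^2\<close> times the first equation from the second removes the
  term of \<open>b\<close>; what remains is linear in \<open>m a\<close> with a nonzero
  coefficient.\<close>

lemma solve_pair_eq: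
  assumes "(\<Sum>k\<in>UNIV. m k * d k) = 0" "(\<Sum>k\<in>UNIV. m k * d k ^ 3) = 0"
    and "d a \<noteq> 0" "(d a)\<^sup>2 \<noteq> (d b)\<^sup>2"
  shows "m a = solve_pair m d a b"
proof -
  have ab: "a \<noteq> b" using assms by auto
  let ?g = "\<lambda>j. m j * (d j * ((d j)\<^sup>2 - (d b)\<^sup>2))"
  have "sum ?g UNIV = (\<Sum>k\<in>UNIV. m k * d k ^ 3) - (d b)\<^sup>2 * (\<Sum>k\<in>UNIV. m k * d k)"
    by (simp add: sum_distrib_left sum_subtractf[symmetric] algebra_simps power2_eq_square power3_eq_cube)
  then have "0 = sum ?g UNIV" using assms by simp
  also have "\<dots> = ?g a + sum ?g (UNIV - {a})" by (rule sum.remove) auto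
  also have "sum ?g (UNIV - {a}) = ?g b + sum ?g (UNIV - {a} - {b})"
    by (rule sum.remove) (use ab in auto)
  also have "UNIV - {a} - {b} = UNIV - {a,b}" by auto
  finally show ?thesis using assms(3,4) by (simp add: solve_pair_def field_simps)
qed

lemma differentiable_real_sqrt:
  assumes "g differentiable at x" "g x > 0"
  shows "(\<lambda>x. sqrt (g x)) differentiable at x"
  using assms has_derivative_real_sqrt unfolding differentiable_def by blast

lemma differentiable_real_cos:
  fixes g :: "_ \<Rightarrow> real"
  shows "g differentiable at x \<Longrightarrow> (\<lambda>x. cos (g x)) differentiable at x"
  using has_derivative_cos unfolding differentiable_def by blast

lemma differentiable_real_sin:
  fixes g :: "_ \<Rightarrow> real"
  shows "g differentiable at x \<Longrightarrow> (\<lambda>x. sin (g x)) differentiable at x"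
  using has_derivative_sin unfolding differentiable_def by blast

lemma differentiable_vec_rcis:
  fixes r \<theta> :: "'a::euclidean_space \<Rightarrow> 'n::finite \<Rightarrow> real"
  assumes "\<And>k. (\<lambda>x. r x k) differentiable at x" "\<And>k. (\<lambda>x. \<theta> x k) differentiable at x"
  shows "(\<lambda>x. \<chi> k. rcis (r x k) (\<theta> x k)) differentiable at x"
proof (rule iffD2[OF differentiable_componentwise_within], rule ballI)
  fix i :: "complex^'n" assume "i \<in> Basis"
  then obtain k e where i: "i = axis k e" by (auto simp: Basis_vec_def)
  have "(\<lambda>x. (\<chi> k. rcis (r x k) (\<theta> x k)) \<bullet> i) =
      (\<lambda>x. r x k * cos (\<theta> x k) * Re e + r x k * sin (\<theta> x k) * Im e)"
    by (simp add: i inner_axis inner_complex_def)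
  then show "(\<lambda>x. (\<chi> k. rcis (r x k) (\<theta> x k)) \<bullet> i) differentiable at x"
    using assms by (simp add: differentiable_real_cos differentiable_real_sin)
qed

lemma negligible_Re_component: "negligible {w::complex^'n. Re (w $ k) = 0}"
proof -
  have "negligible {w::complex^'n. axis k 1 \<bullet> w = 0}"
    by (rule negligible_hyperplane) (simp add: axis_eq_0_iff)
  then show ?thesis by (simp add: inner_axis' inner_complex_def)
qed

text \<open>Dimension count for \<open>N = CARD('n)\<close>: the \<open>N\<close> phases,
  \<open>N - 2\<close> free weights and \<open>Re z\<close> are \<open>2 * N - 1\<close> real
  parameters for \<open>w\<close> in a space of real dimension \<open>2 * N\<close>. Nonzero
  coordinates make all weights positive, where the square root is differentiable.\<close>

lemma negligible_critical_set:
  fixes \<mu> :: "'n::finite \<Rightarrow> real"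
  assumes "inj \<mu>" "CARD('n) \<ge> 4"
  shows "negligible (critical_set \<mu> \<inter> {w. \<forall>k. w $ k \<noteq> 0})"
proof -
  txt \<open>Coordinates \<open>\<zeta>\<close>: the slot \<open>Re (\<zeta> $ a)\<close> carries \<open>Re z\<close>, the slot \<open>Re (\<zeta> $ b)\<close> is unused (hence zero), the other
    real parts are weights, and the imaginary parts are the phases of \<open>w\<close>.\<close>
  define d :: "'n \<Rightarrow> complex^'n \<Rightarrow> 'n \<Rightarrow> real" where "d a \<zeta> k = \<mu> k - Re (\<zeta> $ a)" for a \<zeta> k
  define M :: "'n \<Rightarrow> 'n \<Rightarrow> complex^'n \<Rightarrow> 'n \<Rightarrow> real" where
    "M a b \<zeta> k = (if k = a then solve_pair (\<lambda>j. Re (\<zeta> $ j)) (d a \<zeta>) a b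
                  else if k = b then solve_pair (\<lambda>j. Re (\<zeta> $ j)) (d a \<zeta>) b a else Re (\<zeta> $ k))"
    for a b \<zeta> k
  \<comment> \<open>The last critical equation says that \<open>(Im z)^2\<close> is the weighted
    mean of the \<open>(d k)^2\<close>.\<close>
  define Q where "Q a b \<zeta> = (\<Sum>k\<in>UNIV. M a b \<zeta> k * (d a \<zeta> k)\<^sup>2) / (\<Sum>k\<in>UNIV. M a b \<zeta> k)" for a b \<zeta>
  \<comment> \<open>Inverting \<open>weight\<close> gives the modulus
    \<open>cmod (w $ k) = sqrt m * (d^2 + y^2)\<close>; \<open>rcis\<close> restores the
    phase.\<close>
  define f :: "'n \<Rightarrow> 'n \<Rightarrow> complex^'n \<Rightarrow> complex^'n" where
    "f a b \<zeta> = (\<chi> k. rcis (sqrt (M a b \<zeta> k) * ((d a \<zeta> k)\<^sup>2 + Q a b \<zeta>)) (Im (\<zeta> $ k)))" for a b \<zeta>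
  \<comment> \<open>The inequalities keep the denominators of \<open>solve_pair\<close> and
    \<open>Q\<close> nonzero and the square roots differentiable.\<close>
  define S where "S a b = {\<zeta>. Re (\<zeta> $ b) = 0 \<and> d a \<zeta> a \<noteq> 0 \<and> d a \<zeta> b \<noteq> 0 \<and>
      (d a \<zeta> a)\<^sup>2 \<noteq> (d a \<zeta> b)\<^sup>2 \<and> (\<forall>k. M a b \<zeta> k > 0)}" for a b
  have "negligible (f a b ` S a b)" for a b
  proof (rule negligible_differentiable_image_negligible[OF order_refl])
    show "negligible (S a b)"
      by (rule negligible_subset[OF negligible_Re_component[of b]]) (auto simp: S_def)
    show "f a b differentiable_on S a b"
    proof (rule differentiable_at_imp_differentiable_on)
      fix \<zeta> assume \<zeta>: "\<zeta> \<in> S a b"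
      have Re: "(\<lambda>\<zeta>::complex^'n. Re (\<zeta> $ k)) differentiable at \<zeta>"
        and Im: "(\<lambda>\<zeta>::complex^'n. Im (\<zeta> $ k)) differentiable at \<zeta>" for k
        by (intro bounded_linear_imp_differentiable bounded_linear_compose[OF bounded_linear_Re]
            bounded_linear_compose[OF bounded_linear_Im] bounded_linear_vec_nth)+
      have d: "(\<lambda>\<zeta>. d a \<zeta> k) differentiable at \<zeta>" for k
        unfolding d_def by (simp add: Re)
      have M: "(\<lambda>\<zeta>. M a b \<zeta> k) differentiable at \<zeta>" for k
        unfolding M_def solve_pair_def using \<zeta>
        by (cases "k = a"; cases "k = b")
          (auto simp: S_def intro!: differentiable_divide differentiable_minus differentiable_sum
            differentiable_mult differentiable_diff differentiable_power Re d)
      have "sum (M a b \<zeta>) UNIV > 0"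
        using \<zeta> by (intro sum_pos) (auto simp: S_def)
      then have Q: "(\<lambda>\<zeta>. Q a b \<zeta>) differentiable at \<zeta>"
        unfolding Q_def by (auto intro!: differentiable_divide differentiable_sum
            differentiable_mult differentiable_power M d)
      show "f a b differentiable at \<zeta>"
        unfolding f_def using \<zeta>
        by (intro differentiable_vec_rcis Im differentiable_mult differentiable_real_sqrt
            differentiable_add differentiable_power M Q d) (auto simp: S_def)
    qed
  qed
  \<comment> \<open>Which pair \<open>a\<close>, \<open>b\<close> is suitable depends on
    \<open>Re z\<close>, but there are only finitely many pairs.\<close>
  then have neg: "negligible (\<Union>a. \<Union>b. f a b ` S a b)"
    by (intro negligible_Union) auto
  have cover: "w \<in> (\<Union>a. \<Union>b. f a b ` S a b)" if w: "w \<in> critical_set \<mu>" "\<forall>k. w $ k \<noteq> 0" for w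
  proof -
    obtain z where y: "Im z \<noteq> 0"
      and s1: "(\<Sum>k\<in>UNIV. weight \<mu> w z k * (\<mu> k - Re z)) = 0"
      and s3: "(\<Sum>k\<in>UNIV. weight \<mu> w z k * (\<mu> k - Re z) ^ 3) = 0"
      and s2: "(\<Sum>k\<in>UNIV. weight \<mu> w z k * ((\<mu> k - Re z)\<^sup>2 - (Im z)\<^sup>2)) = 0"
      using w(1) by (auto simp: critical_set_def)
    have pos: "(\<mu> k - Re z)\<^sup>2 + (Im z)\<^sup>2 > 0" for k
      using y by (simp add: sum_power2_gt_zero_iff)
    obtain a b where ab: "\<mu> a \<noteq> Re z" "\<mu> b \<noteq> Re z" "(\<mu> a - Re z)\<^sup>2 \<noteq> (\<mu> b - Re z)\<^sup>2"
      using exists_pair_distinct_squares[OF assms] by blast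
    then have "a \<noteq> b" by auto
    \<comment> \<open>The parameters read off from \<open>w\<close> and \<open>z\<close>, which
      \<open>f a b\<close> sends back to \<open>w\<close>.\<close>
    define \<zeta> :: "complex^'n" where
      "\<zeta> = (\<chi> k. Complex (if k = a then Re z else if k = b then 0 else weight \<mu> w z k) (Arg (w $ k)))"
    have d: "d a \<zeta> k = \<mu> k - Re z" for k by (simp add: d_def \<zeta>_def)
    have solve_cong: "solve_pair (\<lambda>j. Re (\<zeta> $ j)) (d a \<zeta>) a' b' = solve_pair (weight \<mu> w z) (\<lambda>k. \<mu> k - Re z) a' b'"
      if "{a', b'} = {a, b}" for a' b'
      unfolding solve_pair_def d using that by (auto simp: \<zeta>_def intro!: arg_cong2[where f="(/)"] sum.cong)
    have M: "M a b \<zeta> k = weight \<mu> w z k" for k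
      using ab solve_pair_eq[OF s1 s3, of a b] solve_pair_eq[OF s1 s3, of b a] \<open>a \<noteq> b\<close>
      by (auto simp: M_def solve_cong insert_commute) (simp add: \<zeta>_def)
    have wpos: "weight \<mu> w z k > 0" for k
      unfolding weight_def using w(2) pos[of k] by (intro divide_pos_pos zero_less_power) auto
    then have "sum (weight \<mu> w z) UNIV > 0" by (intro sum_pos) auto
    moreover have "(\<Sum>k\<in>UNIV. weight \<mu> w z k * (\<mu> k - Re z)\<^sup>2) = sum (weight \<mu> w z) UNIV * (Im z)\<^sup>2"
      using s2 by (simp add: right_diff_distrib sum_subtractf sum_distrib_right)
    ultimately have Q: "Q a b \<zeta> = (Im z)\<^sup>2"
      by (simp add: Q_def M d)
    have "sqrt (weight \<mu> w z k) * ((\<mu> k - Re z)\<^sup>2 + (Im z)\<^sup>2) = cmod (w $ k)" for k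
      using y by (simp add: weight_def real_sqrt_divide)
    then have "f a b \<zeta> = w"
      by (simp add: f_def vec_eq_iff M d Q) (simp add: \<zeta>_def rcis_cmod_Arg)
    moreover have "\<zeta> \<in> S a b"
      using ab \<open>a \<noteq> b\<close> by (simp add: S_def d M wpos) (simp add: \<zeta>_def)
    ultimately show ?thesis by blast
  qed
  show ?thesis
    by (rule negligible_subset[OF neg]) (use cover in blast)
qed

section \<open>Borel measurability and passage to the sphere\<close>

lemma borel_critical_set:
  fixes \<mu> :: "'n::finite \<Rightarrow> real"
  shows "critical_set \<mu> \<in> sets borel"
proof -
  txt \<open>A countable union of projections of compact sets.\<close>
  define g :: "complex \<times> (complex^'n) \<Rightarrow> real \<times> real \<times> real" where
    "g p = ((\<Sum>k\<in>UNIV. weight \<mu> (snd p) (fst p) k * (\<mu> k - Re (fst p))),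
            (\<Sum>k\<in>UNIV. weight \<mu> (snd p) (fst p) k * (\<mu> k - Re (fst p)) ^ 3),
            (\<Sum>k\<in>UNIV. weight \<mu> (snd p) (fst p) k * ((\<mu> k - Re (fst p))\<^sup>2 - (Im (fst p))\<^sup>2)))" for p
  \<comment> \<open>The ball gives boundedness; the closed condition on \<open>Im\<close> keeps the
    denominators in \<open>weight\<close> nonzero, so that \<open>g\<close> is continuous on
    \<open>K n\<close>. \<open>Suc\<close> avoids division by zero at \<open>n = 0\<close>.\<close>
  define K :: "nat \<Rightarrow> (complex \<times> (complex^'n)) set" where
    "K n = cball 0 (real n) \<inter> {p. \<bar>Im (fst p)\<bar> \<ge> 1 / Suc n}" for n
  have "compact {p \<in> K n. g p = 0}" for n
  proof -
    have cl: "closed (K n)"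
      unfolding K_def by (intro closed_Int closed_cball closed_Collect_le continuous_intros)
    have nz: "Im (fst p) \<noteq> 0" if "p \<in> K n" for p
      using that by (auto simp: K_def)
    have pos: "(\<mu> k - Re (fst p))\<^sup>2 + (Im (fst p))\<^sup>2 \<noteq> 0" if "p \<in> K n" for p k
      using nz[OF that] by (simp add: sum_power2_eq_zero_iff)
    have "continuous_on (K n) g"
      unfolding g_def weight_def using pos
      by (intro continuous_intros) auto
    then have "closed {p \<in> K n. g p = 0}"
      using cl by (rule continuous_closed_preimage_constant)
    moreover have "bounded {p \<in> K n. g p = 0}"
      by (rule bounded_subset[OF bounded_cball[of 0 "real n"]]) (auto simp: K_def)
    ultimately show ?thesis by (simp add: compact_eq_bounded_closed)
  qed
  then have "snd ` {p \<in> K n. g p = 0} \<in> sets borel" for n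
    by (intro borel_compact compact_continuous_image continuous_intros)
  then have "(\<Union>n. snd ` {p \<in> K n. g p = 0}) \<in> sets borel"
    by blast
  moreover have "critical_set \<mu> = (\<Union>n. snd ` {p \<in> K n. g p = 0})"
  proof (intro equalityI subsetI)
    fix w assume "w \<in> critical_set \<mu>"
    then obtain z where z: "Im z \<noteq> 0" "g (z, w) = 0"
      by (auto simp: critical_set_def g_def zero_prod_def)
    obtain n1 where n1: "norm (z, w) \<le> real n1"
      using real_arch_simple by blast
    obtain n2 where n2: "1 / Suc n2 < \<bar>Im z\<bar>"
      using z(1) nat_approx_posE[of "\<bar>Im z\<bar>"] by auto
    have "1 / real (Suc (max n1 n2)) \<le> 1 / Suc n2"
      by (intro divide_left_mono) auto
    then have "(z, w) \<in> K (max n1 n2)"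
      using n1 n2 by (simp add: K_def)
    then show "w \<in> (\<Union>n. snd ` {p \<in> K n. g p = 0})"
      using z(2) by force
  next
    fix w assume "w \<in> (\<Union>n. snd ` {p \<in> K n. g p = 0})"
    then obtain n z where "(z, w) \<in> K n" "g (z, w) = 0" by auto
    moreover from this have "Im z \<noteq> 0" by (auto simp: K_def)
    ultimately show "w \<in> critical_set \<mu>"
      by (auto simp: critical_set_def g_def zero_prod_def)
  qed
  ultimately show ?thesis by simp
qed

text \<open>All weights are multiplied by \<open>c\<^sup>2\<close>, and the three equations are
  homogeneous in the weights.\<close>

lemma critical_set_scaleR:
  assumes "c \<noteq> 0" "c *\<^sub>R w \<in> critical_set \<mu>"
  shows "w \<in> critical_set \<mu>"
proof -
  have "weight \<mu> (c *\<^sub>R w) z k = c\<^sup>2 * weight \<mu> w z k" for z k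
    by (simp add: weight_def power_mult_distrib)
  then show ?thesis
    using assms by (auto simp: critical_set_def mult.assoc simp flip: sum_distrib_left)
qed

text \<open>If \<open>w k = 0\<close>, then \<open>\<mu> k\<close> is an eigenvalue at every time,
  so such vectors must be excluded too.\<close>

definition bad_set :: "('n::finite \<Rightarrow> real) \<Rightarrow> (complex^'n) set" where
  "bad_set \<mu> = critical_set \<mu> \<union> {w. \<exists>k. w $ k = 0}"

lemma borel_bad_set:
  fixes \<mu> :: "'n::finite \<Rightarrow> real"
  shows "bad_set \<mu> \<in> sets borel"
proof -
  have "closed {w :: complex^'n. w $ k = 0}" for k
    by (intro closed_Collect_eq continuous_intros)
  then have "(\<Union>k. {w :: complex^'n. w $ k = 0}) \<in> sets borel"
    by (intro sets.finite_UN borel_closed) auto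
  then show ?thesis
    unfolding bad_set_def Collect_ex_eq using borel_critical_set by (rule sets.Un[rotated])
qed

lemma negligible_bad_set:
  fixes \<mu> :: "'n::finite \<Rightarrow> real"
  assumes "inj \<mu>" "CARD('n) \<ge> 4"
  shows "negligible (bad_set \<mu>)"
proof -
  have "negligible (\<Union>k. {w :: complex^'n. Re (w $ k) = 0})"
    by (intro negligible_Union) (auto intro: negligible_Re_component)
  then have "negligible ((critical_set \<mu> \<inter> {w. \<forall>k. w $ k \<noteq> 0}) \<union> (\<Union>k. {w. Re (w $ k) = 0}))"
    using negligible_critical_set[OF assms] by (rule negligible_Un[rotated])
  then show ?thesis
    by (rule negligible_subset) (auto simp: bad_set_def, (metis zero_complex.sel(1))+)
qed

lemma bad_set_scaleR: "c \<noteq> 0 \<Longrightarrow> c *\<^sub>R w \<in> bad_set \<mu> \<Longrightarrow> w \<in> bad_set \<mu>"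
  using critical_set_scaleR by (auto simp: bad_set_def)

text \<open>\<open>sphere_unif\<close> is the image of the uniform measure on the ball under
  normalization. Scale invariance shows that a point whose normalization lies in \<open>B\<close> is
  itself in \<open>B\<close>; \<open>0 \<in> B\<close> excludes the origin, which cannot be
  normalized.\<close>

lemma AE_sphere_unif_not_mem:
  fixes B :: "(complex^'n) set"
  assumes "B \<in> sets borel" "negligible B" "0 \<in> B"
    and scale: "\<And>c w. c \<noteq> 0 \<Longrightarrow> c *\<^sub>R w \<in> B \<Longrightarrow> w \<in> B"
  shows "AE v in sphere_unif. v \<notin> B"
proof -
  have "B \<in> null_sets (lborel :: (complex^'n) measure)"
    using assms(1,2) by (simp add: negligible_iff_null_sets null_sets_completion_iff)
  then have "AE x in lborel. x \<notin> B" by (rule AE_not_in)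
  then have "AE x in lborel. x \<in> ball 0 1 \<longrightarrow> x /\<^sub>R norm x \<notin> B"
  proof eventually_elim
    case (elim x)
    then have "x \<noteq> 0" using assms(3) by auto
    then show ?case using scale[of "inverse (norm x)" x] elim by auto
  qed
  then have "AE x in uniform_measure lborel (ball 0 1). x /\<^sub>R norm x \<notin> B"
    by (intro AE_uniform_measureI) auto
  moreover have "(\<lambda>x. x /\<^sub>R norm x) \<in> measurable (uniform_measure lborel (ball 0 1)) (borel :: (complex^'n) measure)"
    by measurable
  moreover have "{x \<in> space borel. x \<notin> B} \<in> sets borel"
    using assms(1) by (simp flip: Compl_eq)
  ultimately show ?thesis
    unfolding sphere_unif_def by (subst AE_distr_iff) auto
qed

section \<open>Spectra for generic vectors and the theorem\<close>

lemma eigenvalues_diag_generic: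
  fixes w :: "complex^'n"
  assumes "inj \<mu>" "w \<notin> bad_set \<mu>"
  shows "t > 0 \<Longrightarrow> card (eigenvalues (Gt (diag \<mu>) w t)) = CARD('n)"
    and "s \<ge> 0 \<Longrightarrow> t > s \<Longrightarrow> eigenvalues (Gt (diag \<mu>) w s) \<inter> eigenvalues (Gt (diag \<mu>) w t) = {}"
proof -
  define F :: "complex \<Rightarrow> complex" where "F c = (\<Sum>k\<in>UNIV. of_real ((cmod (w $ k))\<^sup>2) / (of_real (\<mu> k) - c))" for c
  have w: "w $ k \<noteq> 0" for k using assms(2) by (auto simp: bad_set_def)
  have ev: "eigenvalues (Gt (diag \<mu>) w t) =
      {c. c \<notin> range (\<lambda>k. of_real (\<mu> k)) \<and> 1 + \<i> * of_real t * F c = 0}" if "t > 0" for t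
    unfolding F_def using eigenvalues_Gt_diag[OF assms(1) w that] .
  show "card (eigenvalues (Gt (diag \<mu>) w t)) = CARD('n)" if t: "t > 0"
  proof -
    let ?r = "\<lambda>k. \<i> * of_real t * of_real ((cmod (w $ k))\<^sup>2)"
    have F: "\<i> * of_real t * F c = (\<Sum>k\<in>UNIV. ?r k / (of_real (\<mu> k) - c))" for c
      by (simp add: F_def sum_distrib_left)
    have F2: "\<i> * of_real t * (\<Sum>k\<in>UNIV. of_real ((cmod (w $ k))\<^sup>2) / (of_real (\<mu> k) - c)\<^sup>2)
        = (\<Sum>k\<in>UNIV. ?r k / (of_real (\<mu> k) - c)\<^sup>2)" for c
      by (simp add: sum_distrib_left)
    show ?thesis
      unfolding ev[OF t] F
    proof (rule card_zeros_partial_fractions)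
      show "inj (\<lambda>k. complex_of_real (\<mu> k))" using assms(1) by (auto simp: inj_def)
      show "?r k \<noteq> 0" for k using t w by simp
      fix c assume "1 + (\<Sum>k\<in>UNIV. ?r k / (of_real (\<mu> k) - c)) = 0"
      then have "1 + \<i> * of_real t * F c = 0" by (simp only: F)
      then show "(\<Sum>k\<in>UNIV. ?r k / (of_real (\<mu> k) - c)\<^sup>2) \<noteq> 0"
        using double_root_imp_critical[OF t, of w \<mu> c] assms(2) t
        unfolding F2[symmetric] F_def bad_set_def by auto
    qed
  qed
  show "eigenvalues (Gt (diag \<mu>) w s) \<inter> eigenvalues (Gt (diag \<mu>) w t) = {}" if "s \<ge> 0" "t > s"
  proof (cases "s = 0")
    case True
    \<comment> \<open>At time 0 the eigenvalues are among the \<open>\<mu> k\<close>, which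
      \<open>ev\<close> excludes from the spectrum at time \<open>t > 0\<close>.\<close>
    have "c \<in> range (\<lambda>k. of_real (\<mu> k))" if "c \<in> eigenvalues (Gt (diag \<mu>) w 0)" for c
    proof -
      obtain x where x: "x \<noteq> 0" "diag \<mu> *v x = c *s x"
        using \<open>c \<in> eigenvalues (Gt (diag \<mu>) w 0)\<close> by (auto simp: eigenvalues_def Gt_conv_matrix_vector)
      then obtain k where "x $ k \<noteq> 0" by (auto simp: vec_eq_iff)
      moreover have "of_real (\<mu> k) * x $ k = c * x $ k"
        using arg_cong[OF x(2), of "\<lambda>v. v $ k"]
        by (simp add: matrix_vector_mult_def diag_def if_distrib[of "\<lambda>y. y * _"] cong: if_cong)
      ultimately show ?thesis by auto
    qed
    then show ?thesis using ev[of t] that True by auto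
  next
    case False
    then have "s > 0" "t > 0" using that by auto
    moreover have "s = t" if "1 + \<i> * of_real s * F c = 0" "1 + \<i> * of_real t * F c = 0" for c
    proof -
      have "\<i> * of_real s * F c = \<i> * of_real t * F c"
        using that by (metis add_left_cancel)
      moreover have "F c \<noteq> 0" using that by auto
      ultimately show ?thesis by simp
    qed
    ultimately show ?thesis using ev \<open>t > s\<close> by auto
  qed
qed

theorem theorem1p3:
  fixes H :: "complex^'n^'n"
  assumes "CARD('n) \<ge> 5"
    and "hermitian H"
    and "card (eigenvalues H) = CARD('n)"
  shows "AE v in sphere_unif.
           (\<forall>t\<ge>0. card (eigenvalues (Gt H v t)) = CARD('n)) \<and>
           (\<forall>t s. t \<ge> 0 \<and> s \<ge> 0 \<and> t \<noteq> s \<longrightarrow>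
                  eigenvalues (Gt H v t) \<inter> eigenvalues (Gt H v s) = {})"
proof -
  obtain E :: "complex^'n^'n" and \<mu> :: "'n \<Rightarrow> real"
    where \<mu>: "inj \<mu>" and E: "adj E ** E = mat 1" "H ** E = E ** diag \<mu>"
    using hermitian_diagonalization[OF assms(2,3)] by blast
  have E': "E ** adj E = mat 1" using E(1) matrix_left_right_inverse by blast
  define B where "B = (*v) (adj E) -` bad_set \<mu>"
  have "AE v in sphere_unif. v \<notin> B"
  proof (rule AE_sphere_unif_not_mem)
    have "(*v) (adj E) \<in> borel_measurable borel"
      by (intro borel_measurable_continuous_onI continuous_intros)
    then show "B \<in> sets borel"
      unfolding B_def using borel_bad_set measurable_sets by (metis inf_top.right_neutral space_borel)
    \<comment> \<open>Rewriting the preimage as an image under the inverse map makes the null-set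
      theorem for differentiable images applicable.\<close>
    have "B = (*v) E ` bad_set \<mu>"
    proof (intro equalityI subsetI)
      fix v assume "v \<in> B"
      moreover have "v = E *v (adj E *v v)" by (simp add: matrix_vector_mul_assoc E')
      ultimately show "v \<in> (*v) E ` bad_set \<mu>" unfolding B_def by blast
    qed (auto simp: B_def matrix_vector_mul_assoc E)
    also have "negligible \<dots>"
      using \<mu> assms(1)
      by (intro negligible_differentiable_image_negligible negligible_bad_set linear_imp_differentiable_on
          bounded_linear.linear matrix_vector_mul_bounded_linear) auto
    finally show "negligible B" .
    show "0 \<in> B" by (simp add: B_def bad_set_def)
    show "w \<in> B" if "c \<noteq> 0" "c *\<^sub>R w \<in> B" for c w
      using that bad_set_scaleR unfolding B_def
      by (auto simp: linear_scale[OF bounded_linear.linear])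
  qed
  then show ?thesis
  proof eventually_elim
    case (elim v)
    then have w: "adj E *v v \<notin> bad_set \<mu>" by (simp add: B_def)
    \<comment> \<open>At time 0 the eigenvalue count is the assumption on \<open>H\<close>; positive
      times come from the generic case.\<close>
    have "Gt H v 0 = H" by (simp add: Gt_def vec_eq_iff)
    then have "card (eigenvalues (Gt H v t)) = CARD('n)" if "t \<ge> 0" for t
      using that assms(3) eigenvalues_diag_generic(1)[OF \<mu> w, of t]
      by (cases "t = 0") (auto simp: eigenvalues_Gt_diagonalized[OF E])
    moreover have "eigenvalues (Gt H v t) \<inter> eigenvalues (Gt H v s) = {}"
      if "t \<ge> 0" "s \<ge> 0" "t \<noteq> s" for t s
      using that eigenvalues_diag_generic(2)[OF \<mu> w, of s t] eigenvalues_diag_generic(2)[OF \<mu> w, of t s]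
      unfolding eigenvalues_Gt_diagonalized[OF E] by (cases "s < t") auto
    ultimately show ?case by blast
  qed
qed

end
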